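(* Let $h,b:\mathbb R^{n_x}\to\mathbb R$ and $\phi=(\phi_1,\dots,\phi_m):\mathbb R^{n_x}\to\mathbb R^m$ be polynomial, let $\mathcal C=\{x:h(x)\ge0\}$, $\mathcal D=\{x:b(x)\ge0\}$, $\mathcal M=\{x:\phi(x)=0\}$, and assume $\mathcal D\cap\mathcal M$ is compact. Then $\mathcal D\cap\mathcal M\subseteq\mathcal C\cap\mathcal M$ if there exist sum-of-squares polynomials $\sigma_0,\sigma_1,\sigma_2$ in the variables $(x,s)$ (with $s$ a scalar variable), polynomials $\rho_\ell\in\mathbb R[x,s]$ for $\ell=1,\dots,m$, and an integer $k\ge1$ such that the polynomial identity $$\Phi(x,s)+\chi(x,s)+\varphi(x,s)=0$$ holds, where $$\Phi(x,s)=\sigma_0+\sigma_1\, b(x)+\sigma_2\,(-h(x)-s^2),\qquad \chi(x,s)=s^{2k},\qquad \varphi(x,s)=\sum_{\ell=1}^m\rho_\ell(x,s)\,\phi_\ell(x).$$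
   Context: A polynomial is a sum of squares (SOS) if it can be written as $\sum_i p_i^2$ for finitely many polynomials $p_i$. *)

theory Defs
  imports "HOL-Analysis.Analysis"
begin

text \<open>
  Real polynomials are represented by their polynomial functions, using the library predicates
  \<^const>\<open>real_polynomial_function\<close> and \<^const>\<open>polynomial_function\<close>. Since the reals are infinite, a
  polynomial over the reals is determined by its polynomial function, so an identity of
  polynomials is the same as an identity of functions. Polynomials in the variables \<open>(x, s)\<close>
  live on the product space \<open>(real ^ 'n) \<times> real\<close>.
\<close>

definition sos_polynomial :: "('a::real_normed_vector \<Rightarrow> real) \<Rightarrow> bool" where
  "sos_polynomial p \<longleftrightarrow>
     (\<exists>(N::nat) q. (\<forall>i<N. real_polynomial_function (q i)) \<and> p = (\<lambda>z. \<Sum>i<N. (q i z)\<^sup>2))"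

end

theory Submission
  imports Defs
begin

text \<open>
  At a point of \<open>D \<inter> M\<close> with \<open>h x < 0\<close>, evaluating the identity at \<open>s = sqrt (- h x)\<close> kills
  the term of \<open>\<sigma>2\<close> and leaves a sum of nonnegative terms, one of which is \<open>s ^ (2 * k) > 0\<close>.
\<close>

lemma sos_polynomial_nonneg: "sos_polynomial p \<Longrightarrow> p z \<ge> 0"
  by (auto simp: sos_polynomial_def intro: sum_nonneg)

theorem lemma4:
  fixes h b :: "real ^ 'n \<Rightarrow> real"
    and \<phi> :: "real ^ 'n \<Rightarrow> real ^ 'm"
    and C D M :: "(real ^ 'n) set"
  assumes "real_polynomial_function h"
    and "real_polynomial_function b"
    and "polynomial_function \<phi>"
    and "C = {x. h x \<ge> 0}"
    and "D = {x. b x \<ge> 0}"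
    and "M = {x. \<phi> x = 0}"
    and "compact (D \<inter> M)"
    and "\<exists>(\<sigma>0 :: (real ^ 'n) \<times> real \<Rightarrow> real) \<sigma>1 \<sigma>2
           (\<rho> :: 'm \<Rightarrow> (real ^ 'n) \<times> real \<Rightarrow> real) (k::nat).
           sos_polynomial \<sigma>0 \<and> sos_polynomial \<sigma>1 \<and> sos_polynomial \<sigma>2 \<and>
           (\<forall>l. real_polynomial_function (\<rho> l)) \<and> k \<ge> 1 \<and>
           (\<forall>x s. (\<sigma>0 (x, s) + \<sigma>1 (x, s) * b x + \<sigma>2 (x, s) * (- h x - s\<^sup>2))
                  + s ^ (2 * k)
                  + (\<Sum>l\<in>UNIV. \<rho> l (x, s) * \<phi> x $ l) = 0)"
  shows "D \<inter> M \<subseteq> C \<inter> M"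
proof
  fix x assume x: "x \<in> D \<inter> M"
  then have b: "b x \<ge> 0" and \<phi>: "\<phi> x = 0"
    using assms(5,6) by auto
  \<comment> \<open>The identity stays quantified over \<open>s\<close>, because the value of
    \<open>s\<close> to be inserted depends on \<open>h x\<close>.\<close>
  from assms(8) obtain \<sigma>0 \<sigma>1 \<sigma>2 :: "(real ^ 'n) \<times> real \<Rightarrow> real"
      and \<rho> :: "'m \<Rightarrow> (real ^ 'n) \<times> real \<Rightarrow> real" and k :: nat
    where sos: "sos_polynomial \<sigma>0" "sos_polynomial \<sigma>1"
      and identity: "\<And>x s. (\<sigma>0 (x, s) + \<sigma>1 (x, s) * b x + \<sigma>2 (x, s) * (- h x - s\<^sup>2))
                  + s ^ (2 * k) + (\<Sum>l\<in>UNIV. \<rho> l (x, s) * \<phi> x $ l) = 0"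
    by blast
  have "h x \<ge> 0"
  proof (rule ccontr)
    assume "\<not> h x \<ge> 0"
    then have h: "h x < 0" by simp
    \<comment> \<open>This is a real root of \<open>- h x - s\<^sup>2\<close> in \<open>s\<close>.
      Strictness of \<open>h x < 0\<close> makes it nonzero, so the even power
      \<open>s ^ (2 * k)\<close> is positive and not merely nonnegative.\<close>
    define s where "s = sqrt (- h x)"
    have "s\<^sup>2 = - h x" and "s ^ (2 * k) > 0"
      using h by (simp_all add: s_def)
    moreover have "\<sigma>0 (x, s) \<ge> 0" and "\<sigma>1 (x, s) * b x \<ge> 0"
      using sos b by (simp_all add: sos_polynomial_nonneg)
    \<comment> \<open>The factor of \<open>\<sigma>2\<close> is zero by the choice of
      \<open>s\<close>, and each summand with \<open>\<rho> l\<close> is zero since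
      \<open>\<phi> x = 0\<close>. What remains of the identity is two nonnegative terms plus a
      positive one equal to 0.\<close>
    ultimately show False
      using identity[of x s] \<phi> by simp
  qed
  with x show "x \<in> C \<inter> M"
    using assms(4) by simp
qed

end
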